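(* A triple $(x;y_1,y_2)$ is a nonsingular Markoff triple if and only if there is a unique nontrivial lower Christoffel word $w$, with standard factorization $w=uv$, such that $\{x,y_1,y_2\}=\{m(u),m(v),m(w)\}$ as multisets with $x$ equal to the Markoff number of the even word among $u,v,w$ (and $y_1,y_2$ the Markoff numbers of the two odd words).
   Context: A Markoff triple $(x;y_1,y_2)$ is a triple of positive integers with $2x^2+y_1^2+y_2^2=4xy_1y_2$, where $(y_1,y_2)$ is regarded as unordered; $(1;1,1)$ is the singular Markoff triple and all others are nonsingular. Christoffel words: for coprime positive integers $s,t$, the lower Christoffel word of slope $t/s$ encodes the lattice path from $(0,0)$ to $(s,t)$ using horizontal unit steps (letter $a$) and vertical unit steps (letter $b$) lying below the segment from $(0,0)$ to $(s,t)$ with no lattice point strictly between path and segment; $a$ and $b$ are the trivial ones, nontrivial ones have length $\ge2$. Every nontrivial lower Christoffel word $w$ has a unique standard factorization $w=uv$ with $u,v$ lower Christoffel words. A finite word on $\{a,b\}$ is even (odd) if it contains an even (odd) number of $b$'s; exactly one of $u,v,w$ is even. Cohn matrix: with $A=\begin{pmatrix}3&\sqrt2\\\sqrt2&1\end{pmatrix}$, $B=\begin{pmatrix}\sqrt2&1\\1&\sqrt2\end{pmatrix}$, $N(w)$ is obtained by replacing $a$ by $A$, $b$ by $B$ and multiplying in order. The Markoff number of $w$ is $m(w)=\mathrm{Tr}(N(w))/4$ if $w$ is even and $m(w)=\mathrm{Tr}(N(w))/(2\sqrt2)$ if $w$ is odd. *)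

theory Defs
  imports "HOL-Analysis.Analysis" "HOL-Library.Multiset"
begin

text \<open>
  Markoff triples are a predicate on real numbers, so that the integrality of the
  components is part of the definition (the Markoff numbers of words below are a priori real).
\<close>

definition markoff_triple :: "real \<Rightarrow> real \<Rightarrow> real \<Rightarrow> bool" where
  "markoff_triple x y1 y2 \<longleftrightarrow>
     x \<in> \<int> \<and> y1 \<in> \<int> \<and> y2 \<in> \<int> \<and> 0 < x \<and> 0 < y1 \<and> 0 < y2 \<and>
     2 * x\<^sup>2 + y1\<^sup>2 + y2\<^sup>2 = 4 * x * y1 * y2"

definition nonsingular_markoff_triple :: "real \<Rightarrow> real \<Rightarrow> real \<Rightarrow> bool" where
  "nonsingular_markoff_triple x y1 y2 \<longleftrightarrow>
     markoff_triple x y1 y2 \<and> (x, y1, y2) \<noteq> (1, 1, 1)"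


datatype letter = La | Lb

type_synonym word = "letter list"

definition path_vertex :: "word \<Rightarrow> nat \<Rightarrow> nat \<times> nat" where
  "path_vertex w k = (count_list (take k w) La, count_list (take k w) Lb)"

text \<open>
  The lattice path from \<open>(0,0)\<close> encoded by \<open>w\<close> visits the points \<open>path_vertex w k\<close> for
  \<open>k \<le> length w\<close>.  A point \<open>(i,j)\<close> is on or below the line through \<open>(0,0)\<close> and \<open>(s,t)\<close> iff
  \<open>s * j \<le> t * i\<close>; by convexity it suffices to require this at the vertices of the path.
  A lattice point strictly between path and segment is one strictly below the segment and
  strictly above every point of the path with the same abscissa; such a point necessarily has
  nonnegative coordinates.
\<close>

definition strictly_between :: "nat \<Rightarrow> nat \<Rightarrow> word \<Rightarrow> nat \<times> nat \<Rightarrow> bool" where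
  "strictly_between s t w p \<longleftrightarrow>
     fst p \<le> s \<and> s * snd p < t * fst p \<and>
     (\<forall>k\<le>length w. fst (path_vertex w k) = fst p \<longrightarrow> snd (path_vertex w k) < snd p)"

definition lower_christoffel_of_slope :: "nat \<Rightarrow> nat \<Rightarrow> word \<Rightarrow> bool" where
  "lower_christoffel_of_slope s t w \<longleftrightarrow>
     path_vertex w (length w) = (s, t) \<and>
     (\<forall>k\<le>length w. s * snd (path_vertex w k) \<le> t * fst (path_vertex w k)) \<and>
     (\<nexists>p. strictly_between s t w p)"

definition lower_christoffel :: "word \<Rightarrow> bool" where
  "lower_christoffel w \<longleftrightarrow>
     w = [La] \<or> w = [Lb] \<or>
     (\<exists>s t. 0 < s \<and> 0 < t \<and> coprime s t \<and> lower_christoffel_of_slope s t w)"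

definition nontrivial_lower_christoffel :: "word \<Rightarrow> bool" where
  "nontrivial_lower_christoffel w \<longleftrightarrow> lower_christoffel w \<and> 2 \<le> length w"

definition standard_factorization :: "word \<Rightarrow> word \<Rightarrow> word \<Rightarrow> bool" where
  "standard_factorization w u v \<longleftrightarrow>
     w = u @ v \<and> lower_christoffel u \<and> lower_christoffel v"


definition even_word :: "word \<Rightarrow> bool" where
  "even_word w \<longleftrightarrow> even (count_list w Lb)"

fun cohn_letter :: "letter \<Rightarrow> real^2^2" where
  "cohn_letter La = vector [vector [3, sqrt 2], vector [sqrt 2, 1]]"
| "cohn_letter Lb = vector [vector [sqrt 2, 1], vector [1, sqrt 2]]"

fun cohn_matrix :: "word \<Rightarrow> real^2^2" where
  "cohn_matrix [] = mat 1"
| "cohn_matrix (c # w) = cohn_letter c ** cohn_matrix w"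

definition markoff_number :: "word \<Rightarrow> real" where
  "markoff_number w =
     (if even_word w then trace (cohn_matrix w) / 4
      else trace (cohn_matrix w) / (2 * sqrt 2))"

end

theory Submission imports Defs
begin

text \<open>
  A word is the lower Christoffel word of slope \<open>t/s\<close> iff \<open>0 \<le> t i - s j < s + t\<close> at each
  vertex \<open>(i, j)\<close> of its path.  From this a product of Christoffel words of slopes
  \<open>t1/s1\<close> and \<open>t2/s2\<close> is Christoffel iff \<open>s1 t2 - s2 t1 = 1\<close>, so standard factorizations are
  exactly the nodes of the binary tree with root \<open>(a, b)\<close> and children \<open>(u, uv)\<close>, \<open>(uv, v)\<close> of
  \<open>(u, v)\<close>.  Cohn matrices have determinant 1, hence
  \<open>Tr (U U V) = Tr U Tr (U V) - Tr V\<close>: passing to a child is a Vieta jump of the Markoff triple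
  that replaces a non-maximal component by a new maximum.  Reflecting the maximum of a nonsingular
  triple inverts this step, which gives existence by descent and uniqueness by induction on the tree.
\<close>

section \<open>Christoffel words as lattice paths in a band\<close>

definition defect :: "nat \<Rightarrow> nat \<Rightarrow> word \<Rightarrow> nat \<Rightarrow> int" where
  "defect s t w k = int t * int (count_list (take k w) La) - int s * int (count_list (take k w) Lb)"

text \<open>\<open>defect\<close> is a scaled distance by which the \<open>k\<close>-th vertex lies
  below the segment; by \<open>defect_eq\<close> it is congruent to \<open>t * k\<close> modulo
  \<open>s + t\<close>, so the band makes it the least nonnegative residue. The two letters fit in
  with slopes 0/1 and 1/0.\<close>

definition band :: "nat \<Rightarrow> nat \<Rightarrow> word \<Rightarrow> bool" where
  "band s t w \<longleftrightarrow> count_list w La = s \<and> count_list w Lb = t \<and>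
     (\<forall>k\<le>length w. 0 \<le> defect s t w k \<and> defect s t w k < int (s + t))"

lemma length_eq_counts: "length w = count_list w La + count_list w Lb"
proof (induction w)
  case (Cons c w)
  then show ?case by (cases c) auto
qed simp

lemma band_length: "band s t w \<Longrightarrow> length w = s + t"
  by (simp add: band_def length_eq_counts)

lemma count_take_mono: "k \<le> k' \<Longrightarrow> count_list (take k w) c \<le> count_list (take k' w) c"
  by (metis count_list_append le_add1 le_add_diff_inverse take_add)

lemma count_take_le: "count_list (take k w) c \<le> count_list w c"
  by (metis append_take_drop_id count_list_append le_add1)

lemma count_take_sum:
  "k \<le> length w \<Longrightarrow> count_list (take k w) La + count_list (take k w) Lb = k"
  using length_eq_counts[of "take k w"] by simp

lemma defect_eq:
  assumes "k \<le> length w"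
  shows "defect s t w k = int t * int k - int (s + t) * int (count_list (take k w) Lb)"
proof -
  have "int k = int (count_list (take k w) La) + int (count_list (take k w) Lb)"
    using count_take_sum[OF assms] by linarith
  then show ?thesis unfolding defect_def by (simp add: algebra_simps)
qed

text \<open>An inner vertex on the segment would make \<open>s + t\<close> divide
  \<open>t * k\<close>, hence \<open>k\<close>, as \<open>s + t\<close> is coprime to
  \<open>t\<close>.\<close>

lemma defect_nonzero:
  assumes "coprime s t" "length w = s + t" "0 < k" "k < s + t"
  shows "defect s t w k \<noteq> 0"
proof
  assume "defect s t w k = 0"
  then have "int t * int k = int (s + t) * int (count_list (take k w) Lb)"
    using assms by (simp add: defect_eq)
  then have "t * k = (s + t) * count_list (take k w) Lb"
    by (metis of_nat_eq_iff of_nat_mult)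
  then have "(s + t) dvd t * k" by simp
  moreover have "coprime (s + t) t" using assms(1) by (simp add: coprime_iff_gcd_eq_1)
  ultimately have "(s + t) dvd k" by (simp add: coprime_dvd_mult_right_iff)
  then show False using assms by (simp add: nat_dvd_not_less)
qed

text \<open>Discrete intermediate value argument: each letter raises the count by at most one, so
  the longest prefix with count at most \<open>n\<close> has count \<open>n\<close>.\<close>

lemma count_take_reaches:
  assumes "count_list (take k w) c \<le> n" "n \<le> count_list w c" "k \<le> length w"
  shows "\<exists>k'. k \<le> k' \<and> k' \<le> length w \<and> count_list (take k' w) c = n"
proof -
  define k' where "k' = (GREATEST m. m \<le> length w \<and> count_list (take m w) c \<le> n)"
  let ?P = "\<lambda>m. m \<le> length w \<and> count_list (take m w) c \<le> n"
  have P: "?P k'" unfolding k'_def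
    by (rule GreatestI_nat[where k = k and b = "length w"]) (use assms in auto)
  have max: "m \<le> k'" if "?P m" for m unfolding k'_def
    by (rule Greatest_le_nat[where b = "length w"]) (use that in auto)
  have "count_list (take k' w) c = n"
  proof (rule ccontr)
    assume "count_list (take k' w) c \<noteq> n"
    then have lt: "count_list (take k' w) c < n" using P by simp
    then have "k' \<noteq> length w" using assms by auto
    then have "k' < length w" using P by simp
    then have "count_list (take (Suc k') w) c \<le> Suc (count_list (take k' w) c)"
      by (simp add: take_Suc_conv_app_nth)
    then have "?P (Suc k')" using lt \<open>k' < length w\<close> by auto
    then show False using max by fastforce
  qed
  then show ?thesis using max[of k] assms P by blast
qed

text \<open>If the defect reached \<open>s + t\<close> at a vertex (i, j), the point (i - 1, j + 1),
  whose defect is smaller by \<open>s + t\<close>, would lie on or below the segment, strictly so by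
  coprimality. Vertices over i - 1 precede (i, j), so that point is also above the path.\<close>

lemma lower_christoffel_of_slope_imp_band:
  assumes "coprime s t" and C: "lower_christoffel_of_slope s t w"
  shows "band s t w"
proof -
  have cnt: "count_list w La = s" "count_list w Lb = t"
    using C by (auto simp: lower_christoffel_of_slope_def path_vertex_def)
  have below: "s * count_list (take k w) Lb \<le> t * count_list (take k w) La" if "k \<le> length w" for k
    using C that by (auto simp: lower_christoffel_of_slope_def path_vertex_def)
  have "defect s t w k < int (s + t)" if k: "k \<le> length w" for k
  proof (rule ccontr)
    assume neg: "\<not> defect s t w k < int (s + t)"
    define i where "i = count_list (take k w) La"
    define j where "j = count_list (take k w) Lb"
    have pos: "0 < s + t" using \<open>coprime s t\<close> by (auto intro: ccontr)
    have d: "int t * int i - int s * int j \<ge> int (s + t)"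
      using neg by (simp add: defect_def i_def j_def)
    have le_s: "i \<le> s" using count_take_le cnt by (metis i_def)
    have "i \<noteq> 0"
    proof
      assume "i = 0"
      then have "int s * int j + int (s + t) \<le> 0" using d by simp
      moreover have "int s * int j \<ge> 0" by simp
      ultimately show False using pos by linarith
    qed
    then obtain i' where i': "i = Suc i'" using not0_implies_Suc by blast
    have "int t * int i' - int s * int (Suc j) \<ge> 0" using d i' by (simp add: algebra_simps)
    then have le: "s * Suc j \<le> t * i'" by (smt (verit) of_nat_le_iff of_nat_mult)
    have "s * Suc j \<noteq> t * i'"
    proof
      assume eq: "s * Suc j = t * i'"
      then have "s dvd t * i'" by (metis dvd_triv_left)
      then have "s dvd i'" using \<open>coprime s t\<close> by (simp add: coprime_dvd_mult_right_iff)
      moreover have "i' < s" using le_s i' by simp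
      ultimately have "i' = 0" using nat_dvd_not_less by blast
      then show False using eq \<open>i' < s\<close> by simp
    qed
    then have "s * Suc j < t * i'" using le by simp
    moreover have "count_list (take k' w) Lb < Suc j"
      if "k' \<le> length w" "count_list (take k' w) La = i'" for k'
    proof -
      have "k' \<le> k"
        using count_take_mono[of k k' w La] that i' i_def by (metis Suc_n_not_le_n nat_le_linear)
      then show ?thesis using count_take_mono[of k' k w Lb] j_def by simp
    qed
    ultimately have "strictly_between s t w (i', Suc j)"
      using le_s i' by (auto simp: strictly_between_def path_vertex_def)
    then show False using C by (auto simp: lower_christoffel_of_slope_def)
  qed
  moreover have "0 \<le> defect s t w k" if "k \<le> length w" for k
    using below[OF that] unfolding defect_def by (metis diff_ge_0_iff_ge of_nat_le_iff of_nat_mult)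
  ultimately show ?thesis using cnt by (simp add: band_def)
qed

text \<open>A point (i, j) between path and segment is compared with the vertex on the same
  antidiagonal, of index i + j. The upper bound of the band puts that vertex at height at least j,
  so the path is no lower when it reaches abscissa i.\<close>

lemma band_imp_lower_christoffel_of_slope:
  assumes "band s t w"
  shows "lower_christoffel_of_slope s t w"
proof -
  have cnt: "count_list w La = s" "count_list w Lb = t" and len: "length w = s + t"
    using assms by (auto simp: band_def length_eq_counts)
  have below: "s * count_list (take k w) Lb \<le> t * count_list (take k w) La" if "k \<le> length w" for k
  proof -
    have "0 \<le> defect s t w k" using assms that by (simp add: band_def)
    then show ?thesis by (simp add: defect_def flip: of_nat_mult)
  qed
  have "\<not> strictly_between s t w (i, j)" for i j
  proof
    assume "strictly_between s t w (i, j)"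
    then have i: "i \<le> s" and ij: "s * j < t * i"
      and above: "\<And>k. k \<le> length w \<Longrightarrow> count_list (take k w) La = i \<Longrightarrow> count_list (take k w) Lb < j"
      by (auto simp: strictly_between_def path_vertex_def)
    have "s * j < s * t" using ij i
      by (metis mult.commute mult_le_mono1 order_less_le_trans)
    then have j: "j < t" by simp
    let ?k = "i + j"
    have k: "?k \<le> length w" using i j len by simp
    have "defect s t w ?k < int (s + t)" using assms k by (simp add: band_def)
    then have "int t * int (i + j) < int (s + t) * int (Suc (count_list (take ?k w) Lb))"
      by (simp add: defect_eq[OF k] algebra_simps)
    moreover have "int (s + t) * int j < int t * int (i + j)"
      using ij by (simp add: algebra_simps flip: of_nat_mult)
    ultimately have "int (s + t) * int j < int (s + t) * int (Suc (count_list (take ?k w) Lb))"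
      by linarith
    then have "int j < int (Suc (count_list (take ?k w) Lb))"
      by (rule mult_left_less_imp_less) simp
    then have jk: "j \<le> count_list (take ?k w) Lb" by simp
    then have "count_list (take ?k w) La \<le> i" using count_take_sum[OF k] by simp
    then obtain k' where "?k \<le> k'" "k' \<le> length w" "count_list (take k' w) La = i"
      using count_take_reaches[of ?k w La i] i cnt k by auto
    then show False using above[of k'] jk count_take_mono[of ?k k' w Lb] by simp
  qed
  then show ?thesis using below cnt by (auto simp: lower_christoffel_of_slope_def path_vertex_def)
qed

lemma band_letters: "band 1 0 [La]" "band 0 1 [Lb]"
  by (auto simp: band_def defect_def le_Suc_eq)

lemma lower_christoffel_iff_band: "lower_christoffel w \<longleftrightarrow> (\<exists>s t. coprime s t \<and> band s t w)"
proof
  assume "lower_christoffel w"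
  then consider "w = [La]" | "w = [Lb]"
    | s t where "coprime s t" "lower_christoffel_of_slope s t w"
    unfolding lower_christoffel_def by blast
  then show "\<exists>s t. coprime s t \<and> band s t w"
  proof cases
    case 1
    then show ?thesis using band_letters(1) by (metis coprime_1_left)
  next
    case 2
    then show ?thesis using band_letters(2) by (metis coprime_1_right)
  qed (use lower_christoffel_of_slope_imp_band in blast)
next
  assume "\<exists>s t. coprime s t \<and> band s t w"
  then obtain s t where st: "coprime s t" "band s t w" by blast
  consider "0 < s" "0 < t" | "s = 0" "t = 1" | "s = 1" "t = 0"
    using st(1) by (cases "s = 0"; cases "t = 0") auto
  then show "lower_christoffel w"
  proof cases
    case 1
    then show ?thesis
      using st band_imp_lower_christoffel_of_slope unfolding lower_christoffel_def by blast
  next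
    case 2
    then obtain c where "w = [c]" using band_length[OF st(2)] by (auto simp: length_Suc_conv)
    then show ?thesis by (cases c) (auto simp: lower_christoffel_def)
  next
    case 3
    then obtain c where "w = [c]" using band_length[OF st(2)] by (auto simp: length_Suc_conv)
    then show ?thesis by (cases c) (auto simp: lower_christoffel_def)
  qed
qed

text \<open>Each letter is forced: \<open>La\<close> adds \<open>t\<close> to the defect and
  \<open>Lb\<close> subtracts \<open>s\<close>, and two values \<open>s + t\<close> apart cannot
  both lie in the band.\<close>

lemma band_unique:
  assumes "band s t w" "band s t w'"
  shows "w = w'"
proof -
  have len: "length w = s + t" "length w' = s + t" using assms band_length by auto
  have "take k w = take k w'" if "k \<le> s + t" for k
    using that
  proof (induction k)
    case (Suc k)
    then have IH: "take k w = take k w'" by simp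
    have S: "take (Suc k) w = take k w @ [w ! k]" "take (Suc k) w' = take k w @ [w' ! k]"
      using Suc.prems len IH by (auto simp: take_Suc_conv_app_nth)
    have "0 \<le> defect s t w (Suc k) \<and> defect s t w (Suc k) < int (s + t)"
      "0 \<le> defect s t w' (Suc k) \<and> defect s t w' (Suc k) < int (s + t)"
      using assms Suc.prems len by (auto simp: band_def)
    then have "w ! k = w' ! k"
      unfolding defect_def S by (cases "w ! k"; cases "w' ! k") (auto simp: algebra_simps)
    then show ?case using S by simp
  qed simp
  then show ?thesis using len by (metis order_refl take_all)
qed

section \<open>Concatenation of Christoffel words and determinants of slopes\<close>

text \<open>Compares the line of \<open>u @ v\<close> with that of \<open>u\<close>. The factor
  \<open>s1 + t1\<close> clears the denominator, and the correction term is the determinant of the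
  two slope vectors times the number of letters read.\<close>

lemma defect_append_left:
  assumes "band s1 t1 u" "band s2 t2 v" "k \<le> length u"
  shows "int (s1 + t1) * defect (s1 + s2) (t1 + t2) (u @ v) k
    = int (s1 + s2 + (t1 + t2)) * defect s1 t1 u k + (int s1 * int t2 - int s2 * int t1) * int k"
proof -
  define i where "i = int (count_list (take k u) La)"
  define j where "j = int (count_list (take k u) Lb)"
  have k: "int k = i + j" using count_take_sum[OF assms(3)] by (simp add: i_def j_def flip: of_nat_add)
  show ?thesis using assms(3) unfolding defect_def k by (simp flip: i_def j_def) (simp add: algebra_simps)
qed

text \<open>Same comparison along \<open>v\<close>: here the correction decreases to zero at the end
  of the path.\<close>

lemma defect_append_right:
  assumes "band s1 t1 u" "band s2 t2 v" "k \<le> length v"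
  shows "int (s2 + t2) * defect (s1 + s2) (t1 + t2) (u @ v) (length u + k)
    = int (s1 + s2 + (t1 + t2)) * defect s2 t2 v k
      + (int s1 * int t2 - int s2 * int t1) * (int (s2 + t2) - int k)"
proof -
  define i where "i = int (count_list (take k v) La)"
  define j where "j = int (count_list (take k v) Lb)"
  have k: "int k = i + j" using count_take_sum[OF assms(3)] by (simp add: i_def j_def flip: of_nat_add)
  have "count_list u La = s1" "count_list u Lb = t1" using assms by (auto simp: band_def)
  then show ?thesis unfolding defect_def k by (simp flip: i_def j_def) (simp add: algebra_simps)
qed

lemma band_append:
  assumes u: "band s1 t1 u" and v: "band s2 t2 v"
    and det: "int s1 * int t2 - int s2 * int t1 = 1"
  shows "band (s1 + s2) (t1 + t2) (u @ v)"
proof -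
  have pos: "0 < s1" "0 < t2" using det by (auto intro!: gr0I)
      (smt (verit) of_nat_0_le_iff mult_nonneg_nonneg)+
  have lu: "length u = s1 + t1" and lv: "length v = s2 + t2" using u v band_length by auto
  let ?W = "int (s1 + s2 + (t1 + t2))"
  let ?d = "defect (s1 + s2) (t1 + t2) (u @ v)"
  have "0 \<le> ?d k \<and> ?d k < ?W" if k: "k \<le> length (u @ v)" for k
  proof (cases "k < length u")
    case True
    then have k: "k \<le> length u" by simp
    have eq: "int (s1 + t1) * ?d k = ?W * defect s1 t1 u k + int k"
      using defect_append_left[OF u v k] det by simp
    have b: "0 \<le> defect s1 t1 u k" "defect s1 t1 u k \<le> int (s1 + t1) - 1"
      using u k by (auto simp: band_def)
    have "0 \<le> int (s1 + t1) * ?d k" unfolding eq using b by simp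
    \<comment> \<open>By integrality the defect of \<open>u\<close> is at most
      \<open>|u| - 1\<close>, which leaves room \<open>?W\<close> for the correction
      \<open>k < |u|\<close>.\<close>
    moreover have "?W * defect s1 t1 u k \<le> ?W * (int (s1 + t1) - 1)"
      using b by (intro mult_left_mono) auto
    then have "int (s1 + t1) * ?d k < int (s1 + t1) * ?W"
      unfolding eq using True lu by (simp add: algebra_simps)
    ultimately show ?thesis using pos
      by (metis add_pos_nonneg mult_less_cancel_left_pos of_nat_0_less_iff zero_le zero_le_mult_iff not_le)
  next
    case False
    then obtain k' where k': "k = length u + k'" using le_Suc_ex not_le by metis
    then have kl: "k' \<le> length v" using k by simp
    have eq: "int (s2 + t2) * ?d k = ?W * defect s2 t2 v k' + (int (s2 + t2) - int k')"
      using defect_append_right[OF u v kl] det k' by simp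
    have b: "0 \<le> defect s2 t2 v k'" "defect s2 t2 v k' \<le> int (s2 + t2) - 1"
      using v kl by (auto simp: band_def)
    have "0 \<le> int (s2 + t2) * ?d k" unfolding eq using b kl lv by simp
    moreover have "?W * defect s2 t2 v k' \<le> ?W * (int (s2 + t2) - 1)"
      using b by (intro mult_left_mono) auto
    then have "int (s2 + t2) * ?d k < int (s2 + t2) * ?W"
      unfolding eq using pos by (simp add: algebra_simps)
    ultimately show ?thesis using pos
      by (metis add_nonneg_pos mult_less_cancel_left_pos of_nat_0_less_iff zero_le zero_le_mult_iff not_le)
  qed
  then show ?thesis using u v by (simp add: band_def)
qed

text \<open>The defects are the residues of \<open>t * k\<close> modulo \<open>s + t\<close>, and
  \<open>t\<close> is invertible there.\<close>

lemma band_defect_one: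
  assumes "coprime s t" "band s t w" "2 \<le> s + t"
  shows "\<exists>k<s + t. defect s t w k = 1"
proof -
  have "t \<noteq> 0" using assms by (auto intro: ccontr)
  then obtain d x y where "d dvd t" "d dvd s" and xy: "t * x = s * y + d"
    using bezout_add_strong_nat[of t s] by blast
  then have "d = 1" using \<open>coprime s t\<close> coprime_common_divisor_nat by blast
  \<comment> \<open>From \<open>t * x = s * y + 1\<close> follows
    \<open>t * (x + y) = 1 + y * (s + t)\<close>, so \<open>x + y\<close> is an inverse of
    \<open>t\<close>.\<close>
  define k where "k = (x + y) mod (s + t)"
  have k: "k < s + t" unfolding k_def using assms(3) by (intro mod_less_divisor) linarith
  have kl: "k \<le> length w" using k band_length[OF assms(2)] by simp
  have "t * (x + y) = 1 + y * (s + t)" using xy \<open>d = 1\<close> by (simp add: algebra_simps)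
  then have "(t * k) mod (s + t) = 1 mod (s + t)"
    unfolding k_def by (metis mod_mult_right_eq mod_mult_self1)
  then have "int t * int k mod int (s + t) = 1"
    using assms(3) by (metis mod_less of_nat_1 of_nat_mod of_nat_mult Suc_1 Suc_le_lessD)
  moreover have "defect s t w k mod int (s + t) = int t * int k mod int (s + t)"
    unfolding defect_eq[OF kl] by (metis minus_mult_right mod_mult_self2 uminus_add_conv_diff add.commute)
  moreover have "defect s t w k mod int (s + t) = defect s t w k"
    using assms(2) kl by (simp add: band_def)
  ultimately show ?thesis using k by auto
qed

text \<open>Consider the vertex of \<open>u @ v\<close> with defect 1. Strictly inside
  \<open>u\<close> or \<open>v\<close> the factor has defect at least 1, and the comparison identity
  would make that factor at least as long as \<open>u @ v\<close>. Hence the vertex is the junction,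
  where the defect equals the determinant.\<close>

lemma band_append_det:
  assumes cu: "coprime s1 t1" and cv: "coprime s2 t2" and u: "band s1 t1 u" and v: "band s2 t2 v"
    and cw: "coprime s t" and w: "band s t (u @ v)"
  shows "int s1 * int t2 - int s2 * int t1 = 1"
proof -
  have st: "s = s1 + s2" "t = t1 + t2" using u v w by (auto simp: band_def)
  have lu: "length u = s1 + t1" and lv: "length v = s2 + t2" using u v band_length by auto
  have pos: "0 < s1 + t1" "0 < s2 + t2" using cu cv by (auto intro: ccontr)
  let ?D = "int s1 * int t2 - int s2 * int t1"
  let ?W = "int (s1 + s2 + (t1 + t2))"
  obtain k where k: "k < s + t" and d: "defect s t (u @ v) k = 1"
    using band_defect_one[OF cw w] pos st by auto
  have atu: "defect s t (u @ v) (length u) = ?D"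
    using u st by (simp add: defect_def band_def algebra_simps)
  have D0: "0 \<le> ?D" using w atu unfolding band_def by (metis le_add1 length_append)
  have "k \<noteq> 0" using d by (intro notI) (simp add: defect_def)
  consider "k < length u" | "k = length u" | k' where "k = length u + k'" "0 < k'" "k' < length v"
  proof -
    have "k = length u + (k - length u) \<and> 0 < k - length u \<and> k - length u < length v"
      if "length u < k"
      using k lu lv st that by linarith
    then show thesis using that linorder_less_linear[of k "length u"] by blast
  qed
  then show ?thesis
  proof cases
    case 1
    then have kl: "k \<le> length u" by simp
    have eq: "int (s1 + t1) = ?W * defect s1 t1 u k + ?D * int k"
      using defect_append_left[OF u v kl] d st by simp
    have "defect s1 t1 u k \<noteq> 0" using defect_nonzero[OF cu lu] \<open>k \<noteq> 0\<close> 1 lu by simp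
    moreover have "0 \<le> defect s1 t1 u k" using u kl by (simp add: band_def)
    ultimately have "?W * 1 \<le> ?W * defect s1 t1 u k" by (intro mult_left_mono) auto
    moreover have "0 \<le> ?D * int k" using D0 by simp
    ultimately have "?W * 1 + 0 \<le> ?W * defect s1 t1 u k + ?D * int k" by (rule add_mono)
    then show ?thesis using pos unfolding eq[symmetric] by simp
  next
    case 2
    then show ?thesis using d atu by simp
  next
    case 3
    then have kl: "k' \<le> length v" by simp
    have eq: "int (s2 + t2) = ?W * defect s2 t2 v k' + ?D * (int (s2 + t2) - int k')"
      using defect_append_right[OF u v kl] d st 3 by simp
    have "defect s2 t2 v k' \<noteq> 0" using defect_nonzero[OF cv lv] 3 lv by simp
    moreover have "0 \<le> defect s2 t2 v k'" using v kl by (simp add: band_def)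
    ultimately have "?W * 1 \<le> ?W * defect s2 t2 v k'" by (intro mult_left_mono) auto
    moreover have "0 \<le> ?D * (int (s2 + t2) - int k')" using D0 kl lv by simp
    ultimately have "?W * 1 + 0 \<le> ?W * defect s2 t2 v k' + ?D * (int (s2 + t2) - int k')" by (rule add_mono)
    then show ?thesis using pos unfolding eq[symmetric] by simp
  qed
qed

section \<open>The tree of standard factorizations\<close>

inductive christoffel_pair :: "word \<Rightarrow> word \<Rightarrow> bool" where
  root: "christoffel_pair [La] [Lb]"
| left: "christoffel_pair u v \<Longrightarrow> christoffel_pair u (u @ v)"
| right: "christoffel_pair u v \<Longrightarrow> christoffel_pair (u @ v) v"

lemma christoffel_pair_band:
  assumes "christoffel_pair u v"
  shows "\<exists>s1 t1 s2 t2. band s1 t1 u \<and> band s2 t2 v \<and> int s1 * int t2 - int s2 * int t1 = 1"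
  using assms
proof induction
  case root
  then show ?case using band_letters by fastforce
next
  case (left u v)
  then obtain s1 t1 s2 t2 where *: "band s1 t1 u" "band s2 t2 v"
    "int s1 * int t2 - int s2 * int t1 = 1" by blast
  have "int s1 * int (t1 + t2) - int (s1 + s2) * int t1 = 1"
    using *(3) by (simp add: algebra_simps)
  then show ?case using * band_append[OF *] by blast
next
  case (right u v)
  then obtain s1 t1 s2 t2 where *: "band s1 t1 u" "band s2 t2 v"
    "int s1 * int t2 - int s2 * int t1 = 1" by blast
  have "int (s1 + s2) * int t2 - int s2 * int (t1 + t2) = 1"
    using *(3) by (simp add: algebra_simps)
  then show ?case using * band_append[OF *] by blast
qed

text \<open>Euclidean descent on nonnegative matrices of determinant 1 whose columns are the two
  slope vectors. Subtracting the smaller of two comparable columns undoes a tree step; incomparable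
  columns occur only in the identity matrix, which is the root.\<close>

lemma unimodular_imp_christoffel_pair:
  assumes "s1 * t2 = s2 * t1 + (1::nat)"
  shows "\<exists>u v. christoffel_pair u v \<and> band s1 t1 u \<and> band s2 t2 v"
  using assms
proof (induction "s1 + t1 + s2 + t2" arbitrary: s1 t1 s2 t2 rule: less_induct)
  case less
  have pos: "0 < s1" "0 < t2" using less.prems by (auto intro: gr0I)
  have det: "int s1 * int t2 = int s2 * int t1 + 1"
    using less.prems by (metis of_nat_1 of_nat_add of_nat_mult)
  consider "s1 \<le> s2" "t1 \<le> t2" | "s2 \<le> s1" "t2 \<le> t1" | "s1 < s2" "t2 < t1" | "s2 < s1" "t1 < t2"
    by linarith
  then show ?case
  proof cases
    case 1
    define s t where "s = s2 - s1" and "t = t2 - t1"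
    have e: "s2 = s1 + s" "t2 = t1 + t" using 1 by (auto simp: s_def t_def)
    have "s1 * t = s * t1 + 1" using less.prems unfolding e by (simp add: algebra_simps)
    moreover from this obtain u v where *: "christoffel_pair u v" "band s1 t1 u" "band s t v"
      using less.hyps[of s1 t1 s t] e pos by auto
    ultimately have "band s2 t2 (u @ v)"
      using band_append[of s1 t1 u s t v] e by (simp flip: of_nat_mult)
    then show ?thesis using * christoffel_pair.left by blast
  next
    case 2
    define s t where "s = s1 - s2" and "t = t1 - t2"
    have e: "s1 = s + s2" "t1 = t + t2" using 2 by (auto simp: s_def t_def)
    have "s * t2 = s2 * t + 1" using less.prems unfolding e by (simp add: algebra_simps)
    moreover from this obtain u v where *: "christoffel_pair u v" "band s t u" "band s2 t2 v"
      using less.hyps[of s t s2 t2] e pos by auto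
    ultimately have "band s1 t1 (u @ v)"
      using band_append[of s t u s2 t2 v] e by (simp flip: of_nat_mult)
    then show ?thesis using * christoffel_pair.right by blast
  next
    case 3
    \<comment> \<open>Columns crossed this way have a determinant that is not positive.\<close>
    then have "s1 * t2 \<le> s2 * t1" by (intro mult_le_mono) auto
    then show ?thesis using less.prems by simp
  next
    case 4
    \<comment> \<open>The determinant is at least \<open>s2 + t1 + 1\<close> here, so the
      off-diagonal entries vanish.\<close>
    then have "(s2 + 1) * (t1 + 1) \<le> s1 * t2" by (intro mult_le_mono) auto
    then have "s2 = 0" "t1 = 0" using less.prems by auto
    then have "s1 = 1" "t2 = 1" using less.prems by auto
    then show ?thesis using band_letters christoffel_pair.root \<open>s2 = 0\<close> \<open>t1 = 0\<close> by blast
  qed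
qed

lemma band_nonempty: "coprime s t \<Longrightarrow> band s t w \<Longrightarrow> w \<noteq> []"
  using band_length by fastforce

text \<open>Forwards, \<open>band_append_det\<close> gives determinant 1, the tree has a node with
  the same letter counts, and \<open>band_unique\<close> identifies the words. Backwards,
  determinant 1 yields both coprimality and closure under concatenation.\<close>

lemma standard_factorization_iff_christoffel_pair:
  "nontrivial_lower_christoffel w \<and> standard_factorization w u v
    \<longleftrightarrow> christoffel_pair u v \<and> w = u @ v"
proof safe
  assume "nontrivial_lower_christoffel w" "standard_factorization w u v"
  then have w: "w = u @ v" and "lower_christoffel u" "lower_christoffel v" "lower_christoffel w"
    by (auto simp: nontrivial_lower_christoffel_def standard_factorization_def)
  then obtain s1 t1 s2 t2 s t where *: "coprime s1 t1" "coprime s2 t2" "band s1 t1 u" "band s2 t2 v"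
      "coprime s t" "band s t (u @ v)"
    unfolding lower_christoffel_iff_band by blast
  then have "int s1 * int t2 = int (s2 * t1 + 1)" using band_append_det by fastforce
  then have "s1 * t2 = s2 * t1 + 1" by (metis of_nat_eq_iff of_nat_mult)
  then obtain u' v' where "christoffel_pair u' v'" "band s1 t1 u'" "band s2 t2 v'"
    using unimodular_imp_christoffel_pair by blast
  then show "christoffel_pair u v" using * band_unique by blast
  show "w = u @ v" by fact
next
  assume "christoffel_pair u v"
  then obtain s1 t1 s2 t2 where *: "band s1 t1 u" "band s2 t2 v"
    "int s1 * int t2 - int s2 * int t1 = 1" using christoffel_pair_band by blast
  \<comment> \<open>A Bezout certificate; the integers \<open>c\<close> and \<open>d\<close> may be
    negative, as they must be for \<open>v\<close> and \<open>u @ v\<close>.\<close>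
  have unimod: "coprime a b" if "int a * d - c * int b = 1" for a b c d
  proof -
    have "k dvd 1" if "k dvd int a" "k dvd int b" for k
      using that \<open>int a * d - c * int b = 1\<close> by (metis dvd_diff dvd_mult dvd_mult2)
    then have "coprime (int a) (int b)" by (rule coprimeI) auto
    then show ?thesis by simp
  qed
  have "int s1 * (int t1 + int t2) - (int s1 + int s2) * int t1 = 1"
    using *(3) by (simp add: algebra_simps)
  then have "int (s1 + s2) * (- int t1) - (- int s1) * int (t1 + t2) = 1"
    by (simp add: algebra_simps)
  moreover have "int s2 * (- int t1) - (- int s1) * int t2 = 1"
    using *(3) by (simp add: algebra_simps)
  ultimately have cop: "coprime s1 t1" "coprime s2 t2" "coprime (s1 + s2) (t1 + t2)"
    using *(3) unimod by blast+
  have uv: "lower_christoffel u" "lower_christoffel v" "lower_christoffel (u @ v)"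
    using * cop band_append[OF *] by (auto simp: lower_christoffel_iff_band)
  have "u \<noteq> []" "v \<noteq> []" using * cop band_nonempty by blast+
  then have "2 \<le> length (u @ v)" by (cases u; cases v) auto
  then show "nontrivial_lower_christoffel (u @ v)" "standard_factorization (u @ v) u v"
    using uv by (auto simp: nontrivial_lower_christoffel_def standard_factorization_def)
qed

section \<open>Trace identities and the growth of Markoff numbers\<close>

lemma cohn_matrix_append: "cohn_matrix (u @ v) = cohn_matrix u ** cohn_matrix v"
  by (induction u) (simp_all add: matrix_mul_assoc)

lemma det_cohn_matrix: "det (cohn_matrix w) = 1"
proof (induction w)
  case (Cons c w)
  have "det (cohn_letter c) = 1" by (cases c) (simp_all add: det_2)
  then show ?case using Cons by (simp add: det_mul)
qed simp

text \<open>Cayley-Hamilton for \<open>U\<close>, multiplied by \<open>V\<close>, after taking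
  traces.\<close>

lemma trace_mult_left_twice:
  fixes U V :: "real^2^2"
  shows "trace (U ** (U ** V)) = trace U * trace (U ** V) - det U * trace V"
  by (simp add: trace_def matrix_matrix_mult_def sum_2 det_2 algebra_simps)

lemma trace_mult_right_twice:
  fixes U V :: "real^2^2"
  shows "trace (U ** (V ** V)) = trace (U ** V) * trace V - det V * trace U"
  by (simp add: trace_def matrix_matrix_mult_def sum_2 det_2 algebra_simps)

lemma even_word_append: "even_word (u @ v) \<longleftrightarrow> (even_word u \<longleftrightarrow> even_word v)"
  by (simp add: even_word_def)

text \<open>As parity is additive under concatenation, this amounts to exactly one of
  \<open>u\<close>, \<open>v\<close>, \<open>u @ v\<close> being even.\<close>

lemma christoffel_pair_parity: "christoffel_pair u v \<Longrightarrow> \<not> (even_word u \<and> even_word v)"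
  by (induction rule: christoffel_pair.induct) (auto simp: even_word_append even_word_def)

text \<open>The coefficient of a component's square in the Markoff equation: 2 for the even word,
  which carries \<open>x\<close>.\<close>

definition weight :: "bool \<Rightarrow> real" where
  "weight e = (if e then 2 else 1)"

definition scale :: "bool \<Rightarrow> real" where
  "scale e = (if e then 4 else 2 * sqrt 2)"

lemma trace_cohn_matrix: "trace (cohn_matrix w) = scale (even_word w) * markoff_number w"
  by (simp add: markoff_number_def scale_def)

text \<open>If \<open>u\<close> and \<open>v\<close> have parities \<open>d\<close> and
  \<open>e\<close>, then \<open>d = e\<close> is the parity of \<open>u @ v\<close>. Dividing the
  trace identity by \<open>scale e\<close> thus removes every square root and leaves the coefficient
  \<open>4 / weight e\<close>.\<close>

lemma scale_quotient: "\<not> (d \<and> e) \<Longrightarrow> scale d * scale (d = e) = 4 / weight e * scale e"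
  by (cases d; cases e) (simp_all add: scale_def weight_def)

lemma scale_nonzero: "scale e \<noteq> 0"
  by (simp add: scale_def)

lemma scale_recurrence:
  assumes "\<not> (d \<and> e)" "scale e * c' = scale d * a * (scale (d = e) * c) - scale e * b"
  shows "c' = 4 * a * c / weight e - b"
proof -
  have "scale e * c' = (scale d * scale (d = e)) * (a * c) - scale e * b"
    using assms(2) by (simp add: algebra_simps)
  then have "scale e * c' = scale e * (4 * a * c / weight e - b)"
    unfolding scale_quotient[OF assms(1)] by (simp add: algebra_simps)
  then show ?thesis using scale_nonzero by simp
qed

text \<open>\<open>u @ u @ v\<close> has the parity of \<open>v\<close>, so its number is the second
  root of the Markoff equation in the component of \<open>v\<close>.\<close>

lemma markoff_number_left:
  assumes "christoffel_pair u v"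
  shows "markoff_number (u @ u @ v)
    = 4 * markoff_number u * markoff_number (u @ v) / weight (even_word v) - markoff_number v"
proof (rule scale_recurrence)
  show "\<not> (even_word u \<and> even_word v)" using christoffel_pair_parity[OF assms] .
  have "trace (cohn_matrix (u @ u @ v))
      = trace (cohn_matrix u) * trace (cohn_matrix (u @ v)) - trace (cohn_matrix v)"
    by (simp add: cohn_matrix_append trace_mult_left_twice det_cohn_matrix)
  moreover have "even_word (u @ u @ v) = even_word v" by (auto simp: even_word_append)
  ultimately show "scale (even_word v) * markoff_number (u @ u @ v) =
      scale (even_word u) * markoff_number u * (scale (even_word u = even_word v) * markoff_number (u @ v))
      - scale (even_word v) * markoff_number v"
    by (simp add: trace_cohn_matrix even_word_append[of u v])
qed

lemma markoff_number_right:
  assumes "christoffel_pair u v"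
  shows "markoff_number (u @ v @ v)
    = 4 * markoff_number v * markoff_number (u @ v) / weight (even_word u) - markoff_number u"
proof (rule scale_recurrence)
  show "\<not> (even_word v \<and> even_word u)" using christoffel_pair_parity[OF assms] by blast
  have "trace (cohn_matrix (u @ v @ v))
      = trace (cohn_matrix v) * trace (cohn_matrix (u @ v)) - trace (cohn_matrix u)"
    by (simp add: cohn_matrix_append trace_mult_right_twice det_cohn_matrix)
  moreover have "even_word (u @ v @ v) = even_word u" by (auto simp: even_word_append)
  moreover have "even_word (u @ v) = (even_word v = even_word u)" by (auto simp: even_word_append)
  ultimately show "scale (even_word u) * markoff_number (u @ v @ v) =
      scale (even_word v) * markoff_number v * (scale (even_word v = even_word u) * markoff_number (u @ v))
      - scale (even_word u) * markoff_number u"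
    by (simp add: trace_cohn_matrix)
qed

lemma markoff_number_root:
  "markoff_number [La] = 1" "markoff_number [Lb] = 1" "markoff_number [La, Lb] = 3"
  by (simp_all add: markoff_number_def even_word_def trace_def sum_2 matrix_matrix_mult_def mat_def
      field_simps)

lemma weight_quotient: "4 / weight e \<in> \<int>" "2 \<le> 4 / weight e" "0 < weight e"
  by (auto simp: weight_def)

text \<open>\<open>b\<close> and \<open>c'\<close> are the two roots of a quadratic with leading
  coefficient \<open>weight e\<close>; \<open>r\<close> collects the terms free of the replaced
  component. Since \<open>a\<close> is a positive integer and \<open>4 / weight e\<close> is at
  least 2, \<open>c'\<close> is at least \<open>2 * c - b\<close>, which exceeds
  \<open>c\<close>.\<close>

lemma vieta_step:
  fixes a b c :: real and e :: bool
  assumes int: "a \<in> \<int>" "b \<in> \<int>" "c \<in> \<int>" and pos: "0 < a" "0 < b" "b < c"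
  defines "c' \<equiv> 4 * a * c / weight e - b"
  shows "c' \<in> \<int>" "c < c'"
    and "r + weight e * b\<^sup>2 = 4 * a * b * c \<Longrightarrow> r + weight e * c'\<^sup>2 = 4 * a * c * c'"
proof -
  have c': "c' = (4 / weight e) * (a * c) - b" by (simp add: c'_def)
  show "c' \<in> \<int>" unfolding c' using int weight_quotient(1) by (intro Ints_diff Ints_mult)
  have "1 \<le> a" using int pos by (auto simp: Ints_def)
  then have "c \<le> a * c" using pos by simp
  then have "2 * c \<le> (4 / weight e) * (a * c)"
    using weight_quotient(2)[of e] pos \<open>1 \<le> a\<close> less_imp_le[OF weight_quotient(3)[of e]]
    by (intro mult_mono) auto
  then show "c < c'" unfolding c' using pos by linarith
  have "weight e * (c' + b) = 4 * a * c" using weight_quotient(3)[of e] by (simp add: c'_def)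
  then show "r + weight e * c'\<^sup>2 = 4 * a * c * c'" if "r + weight e * b\<^sup>2 = 4 * a * b * c"
    using that by algebra
qed

text \<open>Integrality and strict maximality of the product are part of the invariant because the
  growth estimate in \<open>vieta_step\<close> draws on them at each tree step.\<close>

lemma christoffel_pair_markoff:
  assumes "christoffel_pair u v"
  shows "markoff_number u \<in> \<int> \<and> markoff_number v \<in> \<int> \<and> markoff_number (u @ v) \<in> \<int> \<and>
    0 < markoff_number u \<and> 0 < markoff_number v \<and>
    markoff_number u < markoff_number (u @ v) \<and> markoff_number v < markoff_number (u @ v) \<and>
    weight (even_word u) * (markoff_number u)\<^sup>2 + weight (even_word v) * (markoff_number v)\<^sup>2
      + weight (even_word (u @ v)) * (markoff_number (u @ v))\<^sup>2
    = 4 * markoff_number u * markoff_number v * markoff_number (u @ v)"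
  using assms
proof induction
  case root
  then show ?case by (simp add: markoff_number_root even_word_def weight_def)
next
  case (left u v)
  note step = vieta_step[where a = "markoff_number u" and b = "markoff_number v"
      and c = "markoff_number (u @ v)" and e = "even_word v", folded markoff_number_left[OF left.hyps]]
  have "even_word (u @ u @ v) = even_word v" by (auto simp: even_word_append)
  then show ?case using left.IH step(1,2)
    step(3)[of "weight (even_word u) * (markoff_number u)\<^sup>2
      + weight (even_word (u @ v)) * (markoff_number (u @ v))\<^sup>2"]
    by (simp add: algebra_simps)
next
  case (right u v)
  note step = vieta_step[where a = "markoff_number v" and b = "markoff_number u"
      and c = "markoff_number (u @ v)" and e = "even_word u", folded markoff_number_right[OF right.hyps]]
  have "even_word (u @ v @ v) = even_word u" by (auto simp: even_word_append)
  then show ?case using right.IH step(1,2)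
    step(3)[of "weight (even_word v) * (markoff_number v)\<^sup>2
      + weight (even_word (u @ v)) * (markoff_number (u @ v))\<^sup>2"]
    by (simp add: algebra_simps)
qed

section \<open>Tagged triples and injectivity along the tree\<close>

text \<open>Numbers alone may coincide, as at the root, where both letters have number 1; the parity
  records whether a number plays the role of \<open>x\<close> or of a \<open>y\<close>.\<close>

definition tag :: "word \<Rightarrow> bool \<times> real" where
  "tag w = (even_word w, markoff_number w)"

definition tags :: "word \<Rightarrow> word \<Rightarrow> (bool \<times> real) multiset" where
  "tags u v = {#tag u, tag v, tag (u @ v)#}"

text \<open>The Vieta involution on the component \<open>r\<close> with \<open>p\<close> and
  \<open>q\<close> fixed.\<close>

definition reflect :: "bool \<times> real \<Rightarrow> bool \<times> real \<Rightarrow> bool \<times> real \<Rightarrow> bool \<times> real" where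
  "reflect p q r = (fst r, 4 * snd p * snd q / weight (fst r) - snd r)"

lemma reflect_reflect: "reflect p q (reflect p q r) = r"
  by (simp add: reflect_def)

lemma reflect_cong: "{#p, q#} = {#p', q'#} \<Longrightarrow> reflect p q r = reflect p' q' r"
  by (auto simp: reflect_def add_eq_conv_ex add_mset_eq_single)

lemma tag_left: "christoffel_pair u v \<Longrightarrow> tag (u @ u @ v) = reflect (tag u) (tag (u @ v)) (tag v)"
  by (auto simp: tag_def reflect_def markoff_number_left even_word_append)

lemma tag_right: "christoffel_pair u v \<Longrightarrow> tag (u @ v @ v) = reflect (tag v) (tag (u @ v)) (tag u)"
  by (auto simp: tag_def reflect_def markoff_number_right even_word_append)

lemma snd_tag_less:
  assumes "christoffel_pair u v"
  shows "snd (tag u) < snd (tag (u @ v))" "snd (tag v) < snd (tag (u @ v))"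
  using christoffel_pair_markoff[OF assms] by (simp_all add: tag_def)

lemma snd_tags_le: "christoffel_pair u v \<Longrightarrow> p \<in># tags u v \<Longrightarrow> snd p \<le> snd (tag (u @ v))"
  using snd_tag_less[of u v] by (auto simp: tags_def)

text \<open>The product is recognizable in the multiset as the only component of maximal
  number.\<close>

lemma tags_eqD:
  assumes "christoffel_pair u v" "christoffel_pair u' v'" "tags u v = tags u' v'"
  shows "tag (u @ v) = tag (u' @ v')" "{#tag u, tag v#} = {#tag u', tag v'#}"
proof -
  have "tag (u @ v) \<in># tags u' v'" by (simp flip: assms(3)) (simp add: tags_def)
  moreover have "tag (u' @ v') \<in># tags u v" by (simp add: assms(3)) (simp add: tags_def)
  ultimately have "snd (tag (u @ v)) = snd (tag (u' @ v'))"
    using snd_tags_le assms(1,2) by (meson order_antisym)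
  then show *: "tag (u @ v) = tag (u' @ v')"
    using \<open>tag (u @ v) \<in># tags u' v'\<close> snd_tag_less[OF assms(2)] by (auto simp: tags_def)
  have "add_mset (tag (u @ v)) {#tag u, tag v#} = add_mset (tag (u' @ v')) {#tag u', tag v'#}"
    using assms(3) by (simp add: tags_def add_mset_commute)
  then show "{#tag u, tag v#} = {#tag u', tag v'#}" using * by simp
qed

lemma ordered_pair_mset_eq:
  assumes "{#p, q#} = {#p', q'#}" "snd p < (snd q :: real)" "snd p' < snd q'"
  shows "p = p' \<and> q = q'"
  using assms by (auto simp: add_eq_conv_ex add_mset_eq_single)

text \<open>At any other node one of the two words is a product with the other as a factor, hence
  has a larger number.\<close>

lemma christoffel_pair_equal_numbers:
  assumes "christoffel_pair u v" "snd (tag u) = snd (tag v)"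
  shows "u = [La] \<and> v = [Lb]"
  using assms snd_tag_less by cases fastforce+

lemma tag_neq:
  assumes "christoffel_pair u v"
  shows "tag u \<noteq> tag v"
proof
  assume "tag u = tag v"
  then have "u = [La] \<and> v = [Lb]" using christoffel_pair_equal_numbers[OF assms] by simp
  then show False using \<open>tag u = tag v\<close> by (simp add: tag_def even_word_def)
qed

lemma tags_root:
  assumes "christoffel_pair u v" "tags u v = tags [La] [Lb]"
  shows "u = [La] \<and> v = [Lb]"
proof -
  have "{#tag u, tag v#} = {#tag [La], tag [Lb]#}"
    using tags_eqD(2)[OF assms(1) christoffel_pair.root assms(2)] .
  then have "tag u \<in># {#tag [La], tag [Lb]#}" "tag v \<in># {#tag [La], tag [Lb]#}"
    by (metis union_single_eq_member add_mset_commute)+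
  then have "snd (tag u) = snd (tag v)"
    by (auto simp: tag_def markoff_number_root)
  then show ?thesis by (rule christoffel_pair_equal_numbers[OF assms(1)])
qed

text \<open>Equal multisets have the same maximum, and reflecting it recovers the multiset of the
  parent, so the induction hypothesis identifies the parents. A left child cannot share its multiset
  with a right child, since that would give both factors of the parent the same tag.\<close>

lemma tags_inject:
  assumes "christoffel_pair u v" "christoffel_pair u' v'" "tags u v = tags u' v'"
  shows "u = u' \<and> v = v'"
  using assms
proof (induction arbitrary: u' v')
  case root
  then show ?case using tags_root by metis
next
  case (left u v)
  have pair: "christoffel_pair u (u @ v)" using left.hyps by (rule christoffel_pair.left)
  note eq = tags_eqD[OF pair left.prems]
  from left.prems(1) show ?case
  proof cases
    case root
    then show ?thesis using tags_root[OF pair] left.prems(2) by auto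
  next
    case l: (left b)
    \<comment> \<open>A product has a larger number than its factor, so the unordered pairs match in
      order.\<close>
    then have "tag u = tag u' \<and> tag (u @ v) = tag (u' @ b)"
      using eq(2) ordered_pair_mset_eq snd_tag_less(1) left.hyps by metis
    moreover from this have "tag v = tag b"
      using eq(1) l left.hyps tag_left reflect_reflect by metis
    ultimately have "tags u v = tags u' b" by (simp add: tags_def)
    then show ?thesis using left.IH l by blast
  next
    case r: (right a)
    have "{#tag u, tag (u @ v)#} = {#tag v', tag (a @ v')#}"
      using eq(2) r by (simp add: add_mset_commute)
    then have *: "tag u = tag v' \<and> tag (u @ v) = tag (a @ v')"
      using ordered_pair_mset_eq snd_tag_less r left.hyps by metis
    moreover have "tag (u @ u @ v) = tag (a @ v' @ v')" using eq(1) r by simp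
    ultimately have "tag v = tag a"
      using r left.hyps tag_left tag_right reflect_reflect by metis
    with * have "tags u v = tags a v'" by (simp add: tags_def add_mset_commute)
    then have "u = a \<and> v = v'" using left.IH r by blast
    \<comment> \<open>The common parent would satisfy \<open>tag u = tag v\<close>.\<close>
    then show ?thesis using * tag_neq left.hyps by metis
  qed
next
  case (right u v)
  have pair: "christoffel_pair (u @ v) v" using right.hyps by (rule christoffel_pair.right)
  note eq = tags_eqD[OF pair right.prems]
  have eq2: "{#tag v, tag (u @ v)#} = {#tag u', tag v'#}" using eq(2) by (simp add: add_mset_commute)
  from right.prems(1) show ?case
  proof cases
    case root
    then show ?thesis using tags_root[OF pair] right.prems(2) by auto
  next
    case l: (left b)
    then have *: "tag v = tag u' \<and> tag (u @ v) = tag (u' @ b)"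
      using eq2 ordered_pair_mset_eq snd_tag_less right.hyps by metis
    moreover have "tag (u @ v @ v) = tag (u' @ u' @ b)" using eq(1) l by simp
    ultimately have "tag u = tag b"
      using l right.hyps tag_left tag_right reflect_reflect by metis
    with * have "tags u v = tags u' b" by (simp add: tags_def add_mset_commute)
    then have "u = u' \<and> v = b" using right.IH l by blast
    then show ?thesis using * tag_neq right.hyps by metis
  next
    case r: (right a)
    have "{#tag v, tag (u @ v)#} = {#tag v', tag (a @ v')#}"
      using eq2 r by (simp add: add_mset_commute)
    then have *: "tag v = tag v' \<and> tag (u @ v) = tag (a @ v')"
      using ordered_pair_mset_eq snd_tag_less(2) r right.hyps by metis
    moreover have "tag (u @ v @ v) = tag (a @ v' @ v')" using eq(1) r by simp
    ultimately have "tag u = tag a"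
      using r right.hyps tag_right reflect_reflect by metis
    with * have "tags u v = tags a v'" by (simp add: tags_def)
    then show ?thesis using right.IH r by blast
  qed
qed

section \<open>Descent on Markoff triples\<close>

text \<open>A component below another one is not the product, so it is the tag of a factor;
  reflecting it is the step to the child in which the product replaces that factor.\<close>

lemma tags_reflect:
  assumes pair: "christoffel_pair u v" and tags: "tags u v = {#p, q, r#}"
    and "snd r < snd p \<or> snd r < snd q"
  shows "\<exists>u' v'. christoffel_pair u' v' \<and> tags u' v' = {#p, q, reflect p q r#}"
proof -
  have "p \<in># tags u v" "q \<in># tags u v" "r \<in># tags u v" unfolding tags by simp_all
  then have "snd r < snd (tag (u @ v))" using assms(3) snd_tags_le[OF pair] by fastforce
  then consider "r = tag u" | "r = tag v"
    using \<open>r \<in># tags u v\<close> by (auto simp: tags_def)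
  then show ?thesis
  proof cases
    case 1
    then have "add_mset r {#p, q#} = add_mset r {#tag v, tag (u @ v)#}"
      using tags by (simp add: tags_def add_mset_commute)
    then have pq: "{#p, q#} = {#tag v, tag (u @ v)#}" by simp
    have "tags (u @ v) v = add_mset (reflect p q r) {#p, q#}"
      unfolding reflect_cong[OF pq] unfolding pq
      using 1 tag_right[OF pair] by (simp add: tags_def add_mset_commute)
    then show ?thesis using christoffel_pair.right[OF pair] by (metis add_mset_commute)
  next
    case 2
    then have "add_mset r {#p, q#} = add_mset r {#tag u, tag (u @ v)#}"
      using tags by (simp add: tags_def add_mset_commute)
    then have pq: "{#p, q#} = {#tag u, tag (u @ v)#}" by simp
    have "tags u (u @ v) = add_mset (reflect p q r) {#p, q#}"
      unfolding reflect_cong[OF pq] unfolding pq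
      using 2 tag_left[OF pair] by (simp add: tags_def add_mset_commute)
    then show ?thesis using christoffel_pair.left[OF pair] by (metis add_mset_commute)
  qed
qed

text \<open>Keeps the two odd components distinct in the descent. \<open>Y\<close> divides
  \<open>X\<close>, and the quotient \<open>k\<close> satisfies
  \<open>k * (2 * Y - k) = 1\<close>.\<close>

lemma markoff_equal_odd:
  fixes X Y :: int
  assumes "0 < X" "0 < Y" "2 * X\<^sup>2 + Y\<^sup>2 + Y\<^sup>2 = 4 * X * Y * Y"
  shows "X = 1 \<and> Y = 1"
proof -
  have eq: "X\<^sup>2 = Y\<^sup>2 * (2 * X - 1)" using assms(3) by (simp add: power2_eq_square algebra_simps)
  then have "Y\<^sup>2 dvd X\<^sup>2" by simp
  then obtain k where k: "X = Y * k" by (auto simp: pow_divides_pow_iff)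
  have "Y\<^sup>2 * k\<^sup>2 = Y\<^sup>2 * (2 * X - 1)" using eq k by (simp add: power_mult_distrib)
  then have "k\<^sup>2 = 2 * X - 1" using assms(2) by simp
  then have "k * (2 * Y - k) = 1" unfolding k by (simp add: power2_eq_square algebra_simps)
  moreover have "0 < k" using assms k by (simp add: zero_less_mult_iff)
  ultimately have "k = 1" by (metis dvd_triv_left zdvd1_eq abs_of_pos)
  with \<open>k * (2 * Y - k) = 1\<close> show ?thesis using k by simp
qed

text \<open>The reflected component is the second root of a monic quadratic with roots \<open>z\<close> and \<open>z'\<close>;
  a negative value at \<open>m\<close> puts \<open>m\<close> strictly between the roots.\<close>

lemma vieta_descent:
  fixes z z' m :: int
  assumes "m\<^sup>2 - (z + z') * m + z * z' < 0" "m < z"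
  shows "z' < m"
proof -
  have "(m - z) * (m - z') < 0" using assms(1) by (simp add: power2_eq_square algebra_simps)
  then show ?thesis using assms(2) by (simp add: mult_less_0_iff)
qed

text \<open>Reflecting the maximal component makes it smaller than another component. This lowers
  the sum, and it is also the premise with which \<open>tags_reflect\<close> climbs back from the
  smaller triple. The descent stops at the root triple (1; 1, 3).\<close>

lemma markoff_triple_tags:
  fixes X Y Z :: int
  assumes "0 < X" "0 < Y" "0 < Z" "2 * X\<^sup>2 + Y\<^sup>2 + Z\<^sup>2 = 4 * X * Y * Z" "(X, Y, Z) \<noteq> (1, 1, 1)"
  shows "\<exists>u v. christoffel_pair u v \<and>
    tags u v = {#(True, real_of_int X), (False, real_of_int Y), (False, real_of_int Z)#}"
  using assms
proof (induction "nat (X + Y + Z)" arbitrary: X Y Z rule: less_induct)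
  case less
  \<comment> \<open>The odd components may be taken in increasing order; \<open>m\<close> carries
    the induction measure over to \<open>A\<close> and \<open>B\<close>.\<close>
  have sorted: "\<exists>u v. christoffel_pair u v \<and>
      tags u v = {#(True, real_of_int X), (False, real_of_int A), (False, real_of_int B)#}"
    if A: "0 < A" and B: "0 < B" and eq: "2 * X\<^sup>2 + A\<^sup>2 + B\<^sup>2 = 4 * X * A * B"
      and sing: "(X, A, B) \<noteq> (1, 1, 1)" and "A \<le> B" and m: "X + A + B = X + Y + Z" for A B
  proof -
    note X = \<open>0 < X\<close>
    have "A \<noteq> B" using markoff_equal_odd X A eq sing by auto
    then have AB: "A < B" using \<open>A \<le> B\<close> by simp
    have AB2: "A\<^sup>2 < B\<^sup>2" using AB A by (simp add: power_strict_mono)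
    consider "B < X" | "X < B" "X = 1" "A = 1" | "X < B" "\<not> (X = 1 \<and> A = 1)" | "X = B" by linarith
    then show ?thesis
    proof cases
      case 1
      \<comment> \<open>The other root of the equation in \<open>X\<close>. It is positive by the
        product of the roots, and it lies below \<open>B\<close> because the quadratic is negative
        at \<open>B\<close>.\<close>
      define X' where "X' = 2 * A * B - X"
      have prod: "X * X' * 2 = A\<^sup>2 + B\<^sup>2"
        using eq by (simp add: X'_def power2_eq_square algebra_simps)
      have "0 < A\<^sup>2 + B\<^sup>2" using A by (simp add: add_pos_nonneg)
      then have X': "0 < X'" using prod X by (metis zero_less_mult_pos mult.assoc zero_less_numeral zero_less_mult_pos2)
      have "B\<^sup>2 * 1 \<le> B\<^sup>2 * A" using A by (intro mult_left_mono) auto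
      then have "2 * B\<^sup>2 - 4 * (B\<^sup>2 * A) + A\<^sup>2 + B\<^sup>2 < 0" using AB2 by linarith
      moreover have "2 * (B\<^sup>2 - (X + X') * B + X * X') = 2 * B\<^sup>2 - 4 * (B\<^sup>2 * A) + A\<^sup>2 + B\<^sup>2"
        using prod by (simp add: X'_def power2_eq_square algebra_simps)
      ultimately have "X' < B" using 1 by (intro vieta_descent[of B X X']) auto
      moreover have "2 * X'\<^sup>2 + A\<^sup>2 + B\<^sup>2 = 4 * X' * A * B"
        using eq by (simp add: X'_def power2_eq_square algebra_simps)
      ultimately obtain u v where uv: "christoffel_pair u v"
        "tags u v = {#(True, real_of_int X'), (False, real_of_int A), (False, real_of_int B)#}"
        using less.hyps[of X' A B] X' A B 1 m AB X by auto
      \<comment> \<open>\<open>tags_reflect\<close> acts on the component listed last.\<close>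
      have "tags u v = {#(False, real_of_int A), (False, real_of_int B), (True, real_of_int X')#}"
        using uv(2) by (simp add: add_mset_commute)
      moreover have "real_of_int X' < real_of_int B" using \<open>X' < B\<close> by simp
      ultimately show ?thesis using tags_reflect[OF uv(1)] by (fastforce simp: reflect_def weight_def X'_def add_mset_commute)
    next
      case 2
      \<comment> \<open>The equation for (1; 1, B), whose root 1 is ruled out by
        \<open>X < B\<close>.\<close>
      have "(B - 1) * (B - 3) = 0"
        using eq 2 by (simp add: power2_eq_square algebra_simps)
      then have "B = 3" using 2 by simp
      then have "tags [La] [Lb] = {#(True, real_of_int X), (False, real_of_int A), (False, real_of_int B)#}"
        using 2 by (simp add: tags_def tag_def markoff_number_root even_word_def)
      then show ?thesis using christoffel_pair.root by blast
    next
      case 3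
      \<comment> \<open>The other root of the equation in \<open>B\<close>. Excluding
        \<open>X = A = 1\<close> keeps the reflected triple nonsingular and makes the estimates
        below strict.\<close>
      define B' where "B' = 4 * X * A - B"
      have prod: "B * B' = 2 * X\<^sup>2 + A\<^sup>2"
        using eq by (simp add: B'_def power2_eq_square algebra_simps)
      have "0 < 2 * X\<^sup>2 + A\<^sup>2" using A by (simp add: add_nonneg_pos)
      then have B': "0 < B'" using prod B by (metis zero_less_mult_pos)
      \<comment> \<open>The quadratic is negative at the larger of the two components that
        stay.\<close>
      have less_max: "B' < max X A"
      proof (cases "A \<le> X")
        case True
        have "X\<^sup>2 * 3 - X\<^sup>2 * (4 * A) + A\<^sup>2 < 0"
        proof (cases "A = 1")
          case True
          then have "1 < X" using 3 X by linarith
          then have "1 < X\<^sup>2" by simp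
          then show ?thesis using True by simp
        next
          case False
          have "A\<^sup>2 \<le> X\<^sup>2" using A \<open>A \<le> X\<close> by (simp add: power_mono)
          moreover have "X\<^sup>2 * 2 \<le> X\<^sup>2 * A" using A False by (intro mult_left_mono) auto
          moreover have "0 < X\<^sup>2" using X by simp
          ultimately show ?thesis by linarith
        qed
        moreover have "X\<^sup>2 - (B + B') * X + B * B' = X\<^sup>2 * 3 - X\<^sup>2 * (4 * A) + A\<^sup>2"
          unfolding prod by (simp add: B'_def power2_eq_square algebra_simps)
        ultimately have "B' < X" using 3 by (intro vieta_descent[of X B B']) auto
        then show ?thesis by simp
      next
        case False
        then have "X\<^sup>2 < A\<^sup>2" using X by (simp add: power_strict_mono)
        moreover have "A\<^sup>2 * 1 \<le> A\<^sup>2 * X" using X by (intro mult_left_mono) auto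
        ultimately have "2 * A\<^sup>2 + 2 * X\<^sup>2 - 4 * (A\<^sup>2 * X) < 0" by linarith
        moreover have "A\<^sup>2 - (B + B') * A + B * B' = 2 * A\<^sup>2 + 2 * X\<^sup>2 - 4 * (A\<^sup>2 * X)"
          unfolding prod by (simp add: B'_def power2_eq_square algebra_simps)
        ultimately have "B' < A" using AB by (intro vieta_descent[of A B B']) auto
        then show ?thesis by simp
      qed
      then have "B' < B" using 3 AB by linarith
      moreover have "2 * X\<^sup>2 + A\<^sup>2 + B'\<^sup>2 = 4 * X * A * B'"
        using eq by (simp add: B'_def power2_eq_square algebra_simps)
      ultimately obtain u v where uv: "christoffel_pair u v"
        "tags u v = {#(True, real_of_int X), (False, real_of_int A), (False, real_of_int B')#}"
        using less.hyps[of X A B'] X A B' 3 AB m by auto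
      have "real_of_int B' < real_of_int X \<or> real_of_int B' < real_of_int A" using less_max by auto
      with tags_reflect[OF uv]
      show ?thesis by (simp add: reflect_def weight_def B'_def)
    next
      case 4
      \<comment> \<open>With \<open>X = B\<close> the equation reads
        \<open>3 * B\<^sup>2 + A\<^sup>2 = 4 * (B\<^sup>2 * A)\<close>, whose left side is less than
        \<open>4 * B\<^sup>2\<close>.\<close>
      have "B\<^sup>2 * 1 \<le> B\<^sup>2 * A" using A by (intro mult_left_mono) auto
      moreover have "3 * B\<^sup>2 + A\<^sup>2 = 4 * (B\<^sup>2 * A)"
        using eq 4 by (simp add: power2_eq_square algebra_simps)
      ultimately show ?thesis using AB2 by linarith
    qed
  qed
  show ?case
  proof (cases "Y \<le> Z")
    case True
    then show ?thesis using sorted[of Y Z] less.prems by auto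
  next
    case False
    then have "\<exists>u v. christoffel_pair u v \<and>
        tags u v = {#(True, real_of_int X), (False, real_of_int Z), (False, real_of_int Y)#}"
      using less.prems by (intro sorted) (auto simp: algebra_simps)
    then show ?thesis by (simp add: add_mset_commute)
  qed
qed

section \<open>From tagged triples to the stated equivalence\<close>

lemma tags_imp_nonsingular:
  assumes pair: "christoffel_pair u v" and tags: "tags u v = {#(True, x), (False, y1), (False, y2)#}"
  shows "nonsingular_markoff_triple x y1 y2"
proof -
  note M = christoffel_pair_markoff[OF pair]
  have "\<forall>p\<in>#tags u v. snd p \<in> \<int> \<and> 0 < snd p" using M by (simp add: tags_def tag_def)
  then have 1: "x \<in> \<int>" "y1 \<in> \<int>" "y2 \<in> \<int>" "0 < x" "0 < y1" "0 < y2" unfolding tags by auto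
  \<comment> \<open>As a sum and a product over the multiset, the Markoff equation transfers without
    knowing which word carries which component.\<close>
  have "(\<Sum>p\<in>#tags u v. weight (fst p) * (snd p)\<^sup>2) = 4 * (\<Prod>p\<in>#tags u v. snd p)"
    using M by (simp add: tags_def tag_def algebra_simps)
  then have 2: "2 * x\<^sup>2 + y1\<^sup>2 + y2\<^sup>2 = 4 * x * y1 * y2"
    unfolding tags by (simp add: weight_def)
  \<comment> \<open>The number of the product exceeds those of its factors.\<close>
  have "\<not> (\<forall>p\<in>#tags u v. snd p = 1)" using M by (auto simp: tags_def tag_def)
  then have "(x, y1, y2) \<noteq> (1, 1, 1)" unfolding tags by auto
  then show ?thesis using 1 2 by (simp add: nonsingular_markoff_triple_def markoff_triple_def)
qed

lemma image_tag_split: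
  "image_mset tag N = image_mset (Pair True) (image_mset markoff_number {#z \<in># N. even_word z#})
    + image_mset (Pair False) (image_mset markoff_number {#z \<in># N. \<not> even_word z#})"
  by (induction N) (auto simp: tag_def)

text \<open>The tagged multiset is the union of its even and odd parts; conversely, projecting it
  and these parts to the numbers yields the three equations.\<close>

lemma tags_eq_iff:
  "tags u v = {#(True, x), (False, y1), (False, y2)#} \<longleftrightarrow>
    {#x, y1, y2#} = {#markoff_number u, markoff_number v, markoff_number (u @ v)#} \<and>
    {#x#} = image_mset markoff_number {#z \<in># {#u, v, u @ v#}. even_word z#} \<and>
    {#y1, y2#} = image_mset markoff_number {#z \<in># {#u, v, u @ v#}. \<not> even_word z#}"
    (is "?L \<longleftrightarrow> ?R")
proof
  have tags: "tags u v = image_mset tag {#u, v, u @ v#}" by (simp add: tags_def)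
  {
    assume ?R
    then have e: "image_mset markoff_number {#z \<in># {#u, v, u @ v#}. even_word z#} = {#x#}"
      and o: "image_mset markoff_number {#z \<in># {#u, v, u @ v#}. \<not> even_word z#} = {#y1, y2#}"
      by metis+
    show ?L unfolding tags image_tag_split e o by simp
  next
    assume L: ?L
    have "image_mset snd (tags u v) = {#markoff_number u, markoff_number v, markoff_number (u @ v)#}"
      by (simp add: tags_def tag_def)
    moreover have "image_mset snd (filter_mset fst (tags u v))
        = image_mset markoff_number {#z \<in># {#u, v, u @ v#}. even_word z#}"
      by (simp add: tags_def tag_def)
    moreover have "image_mset snd {#p \<in># tags u v. \<not> fst p#}
        = image_mset markoff_number {#z \<in># {#u, v, u @ v#}. \<not> even_word z#}"
      by (simp add: tags_def tag_def)
    ultimately show ?R unfolding L by simp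
  }
qed

theorem theorem5p7:
  fixes x y1 y2 :: real
  shows "nonsingular_markoff_triple x y1 y2 \<longleftrightarrow>
    (\<exists>!w. nontrivial_lower_christoffel w \<and>
      (\<exists>u v. standard_factorization w u v \<and>
        {#x, y1, y2#} = {#markoff_number u, markoff_number v, markoff_number w#} \<and>
        {#x#} = image_mset markoff_number {#z \<in># {#u, v, w#}. even_word z#} \<and>
        {#y1, y2#} = image_mset markoff_number {#z \<in># {#u, v, w#}. \<not> even_word z#}))"
proof -
  let ?T = "{#(True, x), (False, y1), (False, y2)#}"
  have iff: "nontrivial_lower_christoffel w \<and>
      (\<exists>u v. standard_factorization w u v \<and>
        {#x, y1, y2#} = {#markoff_number u, markoff_number v, markoff_number w#} \<and>
        {#x#} = image_mset markoff_number {#z \<in># {#u, v, w#}. even_word z#} \<and>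
        {#y1, y2#} = image_mset markoff_number {#z \<in># {#u, v, w#}. \<not> even_word z#})
    \<longleftrightarrow> (\<exists>u v. christoffel_pair u v \<and> w = u @ v \<and> tags u v = ?T)" (is "?P w \<longleftrightarrow> ?Q w") for w
    using standard_factorization_iff_christoffel_pair tags_eq_iff by metis
  show ?thesis unfolding iff
  proof
    assume N: "nonsingular_markoff_triple x y1 y2"
    then have T: "markoff_triple x y1 y2" and S: "(x, y1, y2) \<noteq> (1, 1, 1)"
      by (auto simp: nonsingular_markoff_triple_def)
    obtain X Y Z where XYZ: "x = real_of_int X" "y1 = real_of_int Y" "y2 = real_of_int Z"
      using T by (auto simp: markoff_triple_def elim!: Ints_cases)
    have "real_of_int (2 * X\<^sup>2 + Y\<^sup>2 + Z\<^sup>2) = real_of_int (4 * X * Y * Z)"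
      using T XYZ by (simp add: markoff_triple_def)
    then have "2 * X\<^sup>2 + Y\<^sup>2 + Z\<^sup>2 = 4 * X * Y * Z" by (simp only: of_int_eq_iff)
    then obtain u v where uv: "christoffel_pair u v" "tags u v = ?T"
      using markoff_triple_tags[of X Y Z] T S XYZ by (auto simp: markoff_triple_def)
    show "\<exists>!w. ?Q w"
    proof (rule ex1I[of _ "u @ v"])
      show "?Q (u @ v)" using uv by blast
      \<comment> \<open>\<open>tags_inject\<close> determines both factors, hence the word.\<close>
      show "w = u @ v" if "?Q w" for w using that uv tags_inject by metis
    qed
  next
    assume "\<exists>!w. ?Q w"
    then show "nonsingular_markoff_triple x y1 y2" using tags_imp_nonsingular by blast
  qed
qed

end
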